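(* Let $l \geq 1$ be an integer and let $f_l : \mathbb{B}^l \to \mathbb{B}^l$ be a map such that the asynchronous iteration graph $\Gamma(f_l)$ is strongly connected and the Markov matrix $M$ associated with $f_l$ is doubly stochastic. Let $X$ be a random variable uniformly distributed on $\mathbb{B}^l$, and let $S^0, S^1, S^2, \dots$ be random variables, each uniformly distributed on $\llbracket 1, l\rrbracket$, forming a strategy that is independent of $X$. Define the random sequence $X^0 = X$ and $X^{t+1} = F_{f_l}(S^t, X^t)$ for $t \geq 0$; $X^t$ is the least-significant-coefficient vector obtained after $t$ iterations of the dhCI dissimulation algorithm. Then for every $\epsilon > 0$ there exists a positive integer $q$ such that $|p(X^q) - p(X)| < \epsilon$. Here $p(Z)$ denotes the probability distribution of a random variable $Z$ on $\mathbb{B}^l$, viewed as a vector in $\mathbb{R}^{2^l}$, and $|\cdot|$ is a norm on $\mathbb{R}^{2^l}$.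
   Context: The set $\mathbb{B}=\{0,1\}$. For $f : \mathbb{B}^l \to \mathbb{B}^l$, $i \in \llbracket 1,l\rrbracket$ and $x\in\mathbb{B}^l$, define $$F_f(i,x) = (x_1,\dots,x_{i-1}, f_i(x), x_{i+1},\dots,x_l),$$ which updates only coordinate $i$. The asynchronous iteration graph $\Gamma(f)$ is the directed graph with vertex set $\mathbb{B}^l$ and, for every $x\in\mathbb{B}^l$ and every $i\in\llbracket 1,l\rrbracket$, an arc from $x$ to $F_f(i,x)$. The Markov matrix associated with $f$ is the $2^l\times 2^l$ matrix indexed by $\mathbb{B}^l$ given by $$M_{x,y} = \frac{1}{l}\,\#\{k\in\llbracket 1,l\rrbracket : F_f(k,x)=y\}.$$ It is the transition matrix of the random walk that picks a coordinate $k$ uniformly at random and applies $F_f(k,\cdot)$. "Doubly stochastic" means that all row sums and all column sums are equal to $1$. The dhCI dissimulation algorithm iterates $G_{f_l}(s,x) = (\sigma(s), F_{f_l}(s_0,x))$, where $\sigma$ is the shift on strategies, starting from the least significant coefficients $x$ of a host content and the strategy $s$. The content obtained after $q$ iterations is embedded in place of those coefficients. *)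

theory Defs
  imports "HOL-Probability.Probability" "Graph_Theory.Digraph_Component"
begin

text \<open>
  A finite index type \<open>'l\<close> plays the role of the index set \<open>{1..l}\<close>, so that
  \<open>l = CARD('l) \<ge> 1\<close>, the set of \<open>l\<close>-bit vectors is the type \<open>bool ^ 'l\<close>, and vectors and
  matrices indexed by it live in \<open>real ^ (bool ^ 'l)\<close> and \<open>real ^ (bool ^ 'l) ^ (bool ^ 'l)\<close>.
\<close>

definition async_update :: "(bool ^ 'l \<Rightarrow> bool ^ 'l) \<Rightarrow> 'l \<Rightarrow> bool ^ 'l \<Rightarrow> bool ^ 'l" where
  "async_update f i x = (\<chi> j. if j = i then f x $ i else x $ j)"

text \<open>
  One arc \<open>(x, i)\<close> for every vertex \<open>x\<close> and every index \<open>i\<close>; parallel arcs do not affect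
  connectivity.
\<close>

definition async_graph ::
    "(bool ^ 'l \<Rightarrow> bool ^ 'l) \<Rightarrow> (bool ^ 'l, (bool ^ 'l) \<times> 'l) pre_digraph" where
  "async_graph f =
    \<lparr>verts = UNIV, arcs = UNIV, tail = (\<lambda>(x, i). x), head = (\<lambda>(x, i). async_update f i x)\<rparr>"

definition markov_matrix ::
    "(bool ^ 'l \<Rightarrow> bool ^ 'l) \<Rightarrow> real ^ (bool ^ 'l) ^ (bool ^ 'l::finite)" where
  "markov_matrix f =
    (\<chi> x y. 1 / real CARD('l) * real (card {k. async_update f k x = y}))"

definition doubly_stochastic :: "real ^ 'a ^ 'a::finite \<Rightarrow> bool" where
  "doubly_stochastic A \<longleftrightarrow>
    (\<forall>x. (\<Sum>y\<in>UNIV. A $ x $ y) = 1) \<and> (\<forall>y. (\<Sum>x\<in>UNIV. A $ x $ y) = 1)"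

primrec async_iter ::
    "(bool ^ 'l \<Rightarrow> bool ^ 'l) \<Rightarrow> (nat \<Rightarrow> 'l) \<Rightarrow> bool ^ 'l \<Rightarrow> nat \<Rightarrow> bool ^ 'l" where
  "async_iter f s x 0 = x"
| "async_iter f s x (Suc t) = async_update f (s t) (async_iter f s x t)"

text \<open>
  The map iterated by the dhCI algorithm; the lemma below identifies its second component after
  \<open>t\<close> iterations with the sequence \<open>async_iter\<close>.
\<close>

definition dhCI_step ::
    "(bool ^ 'l \<Rightarrow> bool ^ 'l) \<Rightarrow> (nat \<Rightarrow> 'l) \<times> (bool ^ 'l) \<Rightarrow> (nat \<Rightarrow> 'l) \<times> (bool ^ 'l)" where
  "dhCI_step f = (\<lambda>(s, x). (\<lambda>t. s (Suc t), async_update f (s 0) x))"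

lemma funpow_dhCI_step:
  "(dhCI_step f ^^ t) (s, x) = (\<lambda>k. s (k + t), async_iter f s x t)"
  by (induction t) (simp_all add: dhCI_step_def)

text \<open>
  \<open>prob_space.indep_var\<close> requires both random variables to have the same value type. This version
  for different types says, as there, that the generated sigma-algebras are independent; the
  lemma shows that both agree for equal types.
\<close>

definition indep_rvs ::
    "'w measure \<Rightarrow> 'a measure \<Rightarrow> ('w \<Rightarrow> 'a) \<Rightarrow> 'b measure \<Rightarrow> ('w \<Rightarrow> 'b) \<Rightarrow> bool" where
  "indep_rvs \<Omega> A Y B Z \<longleftrightarrow>
    Y \<in> measurable \<Omega> A \<and> Z \<in> measurable \<Omega> B \<and>
    prob_space.indep_set \<Omega>
      (sets (vimage_algebra (space \<Omega>) Y A)) (sets (vimage_algebra (space \<Omega>) Z B))"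

lemma (in prob_space) indep_rvs_iff_indep_var:
  "indep_rvs M A Y B Z \<longleftrightarrow> indep_var A Y B Z"
  by (simp add: indep_rvs_def indep_var_eq sets_vimage_algebra)

definition prob_vector :: "'w measure \<Rightarrow> ('w \<Rightarrow> 'a) \<Rightarrow> real ^ 'a" where
  "prob_vector \<Omega> Z = (\<chi> x. measure \<Omega> {\<omega> \<in> space \<Omega>. Z \<omega> = x})"

definition is_norm :: "('v::real_vector \<Rightarrow> real) \<Rightarrow> bool" where
  "is_norm N \<longleftrightarrow>
    (\<forall>v. 0 \<le> N v) \<and> (\<forall>v. N v = 0 \<longleftrightarrow> v = 0) \<and>
    (\<forall>c v. N (c *\<^sub>R v) = \<bar>c\<bar> * N v) \<and> (\<forall>v w. N (v + w) \<le> N v + N w)"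

end

theory Submission
  imports Defs
begin

text \<open>
  Already \<open>q = 1\<close> works, with equality of the two distributions: since \<open>S\<^sup>0\<close> is uniform and
  independent of \<open>X\<close>, the law of \<open>X\<^sup>1\<close> is the law of \<open>X\<close> multiplied by the Markov matrix, and
  unit column sums make the uniform law invariant under this multiplication.
\<close>

lemma measure_eq_uniform:
  fixes Z :: "'w \<Rightarrow> 'a::finite"
  assumes "Z \<in> measurable \<Omega> (count_space UNIV)"
    and "distr \<Omega> (count_space UNIV) Z = uniform_count_measure UNIV"
  shows "measure \<Omega> {\<omega> \<in> space \<Omega>. Z \<omega> = a} = 1 / real CARD('a)"
proof -
  have "measure \<Omega> {\<omega> \<in> space \<Omega>. Z \<omega> = a} = measure (distr \<Omega> (count_space UNIV) Z) {a}"
    using assms(1) by (subst measure_distr) (auto intro!: arg_cong[where f = "measure \<Omega>"])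
  also have "\<dots> = 1 / real CARD('a)"
    unfolding assms(2) by (simp add: measure_uniform_count_measure)
  finally show ?thesis .
qed

text \<open>Fixing one coordinate of the strategy is a cylinder event, hence lies in the
  sigma-algebra generated by the whole strategy. Independence of the strategy from \<open>X\<close>
  therefore passes to each single \<open>S t\<close>.\<close>

lemma indep_rvs_measure_component_eq:
  assumes "prob_space \<Omega>"
    and "indep_rvs \<Omega> (PiM UNIV (\<lambda>_. count_space UNIV)) (\<lambda>\<omega> t. S t \<omega>) (count_space UNIV) X"
  shows "measure \<Omega> {\<omega> \<in> space \<Omega>. S t \<omega> = k \<and> X \<omega> = x} =
    measure \<Omega> {\<omega> \<in> space \<Omega>. S t \<omega> = k} * measure \<Omega> {\<omega> \<in> space \<Omega>. X \<omega> = x}"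
proof -
  interpret prob_space \<Omega> by fact
  let ?P = "PiM UNIV (\<lambda>_. count_space UNIV)" and ?A = "{s. s t = k}"
  \<comment> \<open>Measurability of the coordinate projection gives the set relative to
    \<open>space ?P\<close>; that space is all of \<open>UNIV\<close>, so the restriction can then
    be dropped.\<close>
  have "{s \<in> space ?P. s t = k} \<in> sets ?P"
    by measurable
  then have "?A \<in> sets ?P"
    by (simp add: space_PiM)
  then have "(\<lambda>\<omega> t. S t \<omega>) -` ?A \<inter> space \<Omega>
      \<in> sets (vimage_algebra (space \<Omega>) (\<lambda>\<omega> t. S t \<omega>) ?P)"
    by (rule in_vimage_algebra)
  moreover have "X -` {x} \<inter> space \<Omega> \<in> sets (vimage_algebra (space \<Omega>) X (count_space UNIV))"
    by (rule in_vimage_algebra) simp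
  ultimately have "prob (((\<lambda>\<omega> t. S t \<omega>) -` ?A \<inter> space \<Omega>) \<inter> (X -` {x} \<inter> space \<Omega>)) =
      prob ((\<lambda>\<omega> t. S t \<omega>) -` ?A \<inter> space \<Omega>) * prob (X -` {x} \<inter> space \<Omega>)"
    using assms(2) unfolding indep_rvs_def by (blast intro: indep_setD)
  moreover have "((\<lambda>\<omega> t. S t \<omega>) -` ?A \<inter> space \<Omega>) \<inter> (X -` {x} \<inter> space \<Omega>) =
      {\<omega> \<in> space \<Omega>. S t \<omega> = k \<and> X \<omega> = x}"
    "(\<lambda>\<omega> t. S t \<omega>) -` ?A \<inter> space \<Omega> = {\<omega> \<in> space \<Omega>. S t \<omega> = k}"
    "X -` {x} \<inter> space \<Omega> = {\<omega> \<in> space \<Omega>. X \<omega> = x}"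
    by auto
  ultimately show ?thesis
    by simp
qed

text \<open>One step of the random walk: the law of the updated state is the row vector of the law
  of \<open>X\<close> times the Markov matrix. Independence enters as a product formula for point
  events, the form in which the decomposition over pairs of state and index uses it.\<close>

lemma measure_async_update:
  fixes f :: "bool ^ 'l \<Rightarrow> bool ^ 'l::finite"
  assumes "prob_space \<Omega>"
    and [measurable]: "K \<in> measurable \<Omega> (count_space UNIV)" "X \<in> measurable \<Omega> (count_space UNIV)"
    and uniform: "distr \<Omega> (count_space UNIV) K = uniform_count_measure UNIV"
    and indep: "\<And>k x. measure \<Omega> {\<omega> \<in> space \<Omega>. K \<omega> = k \<and> X \<omega> = x} =
      measure \<Omega> {\<omega> \<in> space \<Omega>. K \<omega> = k} * measure \<Omega> {\<omega> \<in> space \<Omega>. X \<omega> = x}"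
  shows "measure \<Omega> {\<omega> \<in> space \<Omega>. async_update f (K \<omega>) (X \<omega>) = y} =
    (\<Sum>x\<in>UNIV. measure \<Omega> {\<omega> \<in> space \<Omega>. X \<omega> = x} * markov_matrix f $ x $ y)"
proof -
  interpret prob_space \<Omega> by fact
  let ?K = "\<lambda>x. {k. async_update f k x = y}"
  let ?E = "\<lambda>(x, k). {\<omega> \<in> space \<Omega>. K \<omega> = k \<and> X \<omega> = x}"
  \<comment> \<open>The event splits according to the pair of values of \<open>X\<close> and
    \<open>K\<close>, over the arcs of the iteration graph that end in \<open>y\<close>. The pieces
    are disjoint because an outcome determines its pair.\<close>
  have "{\<omega> \<in> space \<Omega>. async_update f (K \<omega>) (X \<omega>) = y} = (\<Union>p\<in>Sigma UNIV ?K. ?E p)"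
    by auto
  also have "prob \<dots> = (\<Sum>p\<in>Sigma UNIV ?K. prob (?E p))"
    by (rule finite_measure_finite_Union) (auto simp: disjoint_family_on_def)
  also have "\<dots> = (\<Sum>x\<in>UNIV. \<Sum>k\<in>?K x. prob {\<omega> \<in> space \<Omega>. K \<omega> = k \<and> X \<omega> = x})"
    by (subst sum.Sigma) (auto intro!: sum.cong)
  \<comment> \<open>By independence and uniformity of \<open>K\<close>, the inner summand does not
    depend on \<open>k\<close>. The inner sum is thus \<open>card (?K x)\<close> times
    \<open>1 / real CARD('l)\<close> times the probability of \<open>x\<close>, and the first two
    factors form the matrix entry.\<close>
  also have "\<dots> = (\<Sum>x\<in>UNIV. prob {\<omega> \<in> space \<Omega>. X \<omega> = x} * markov_matrix f $ x $ y)"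
    by (simp add: indep measure_eq_uniform[OF _ uniform] markov_matrix_def mult_ac)
  finally show ?thesis .
qed

theorem theorem1:
  fixes f :: "bool ^ 'l \<Rightarrow> bool ^ 'l::finite"
    and \<Omega> :: "'w measure"
    and X :: "'w \<Rightarrow> bool ^ 'l"
    and S :: "nat \<Rightarrow> 'w \<Rightarrow> 'l"
    and N :: "real ^ (bool ^ 'l) \<Rightarrow> real"
    and \<epsilon> :: real
  assumes "strongly_connected (async_graph f)"
    and "doubly_stochastic (markov_matrix f)"
    and "prob_space \<Omega>"
    and "X \<in> measurable \<Omega> (count_space UNIV)"
    and "distr \<Omega> (count_space UNIV) X = uniform_count_measure UNIV"
    and "\<And>t. S t \<in> measurable \<Omega> (count_space UNIV)"
    and "\<And>t. distr \<Omega> (count_space UNIV) (S t) = uniform_count_measure UNIV"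
    and "indep_rvs \<Omega> (PiM UNIV (\<lambda>_. count_space UNIV)) (\<lambda>\<omega> t. S t \<omega>) (count_space UNIV) X"
    and "is_norm N"
    and "\<epsilon> > 0"
  shows "\<exists>q>0. N (prob_vector \<Omega> (\<lambda>\<omega>. async_iter f (\<lambda>t. S t \<omega>) (X \<omega>) q) - prob_vector \<Omega> X) < \<epsilon>"
proof -
  have "prob_vector \<Omega> (\<lambda>\<omega>. async_iter f (\<lambda>t. S t \<omega>) (X \<omega>) 1) = prob_vector \<Omega> X"
  proof (rule vec_eq_iff[THEN iffD2, rule_format])
    fix y
    have "prob_vector \<Omega> (\<lambda>\<omega>. async_iter f (\<lambda>t. S t \<omega>) (X \<omega>) 1) $ y =
        measure \<Omega> {\<omega> \<in> space \<Omega>. async_update f (S 0 \<omega>) (X \<omega>) = y}"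
      by (simp add: prob_vector_def)
    also have "\<dots> = (\<Sum>x\<in>UNIV. measure \<Omega> {\<omega> \<in> space \<Omega>. X \<omega> = x} * markov_matrix f $ x $ y)"
      by (intro measure_async_update indep_rvs_measure_component_eq assms)
    \<comment> \<open>All states have the same weight under the law of \<open>X\<close>, so it
      factors out and leaves the sum of column \<open>y\<close>, which is 1.\<close>
    also have "\<dots> = 1 / real CARD(bool ^ 'l) * (\<Sum>x\<in>UNIV. markov_matrix f $ x $ y)"
      by (simp only: measure_eq_uniform[OF assms(4,5)] sum_distrib_left)
    also have "\<dots> = prob_vector \<Omega> X $ y"
      using assms(2) measure_eq_uniform[OF assms(4,5)]
      by (simp add: doubly_stochastic_def prob_vector_def)
    finally show "prob_vector \<Omega> (\<lambda>\<omega>. async_iter f (\<lambda>t. S t \<omega>) (X \<omega>) 1) $ y =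
        prob_vector \<Omega> X $ y" .
  qed
  moreover have "N 0 = 0"
    using assms(9) by (simp add: is_norm_def)
  ultimately show ?thesis
    using assms(10) by (intro exI[of _ 1]) simp
qed

end
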